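(* There exists a constant $\alpha>0$ such that the following holds. For even $n$, let $G=H\cup M$, where $H$ is a Hamiltonian cycle on a set of $n$ vertices and $M$ is a uniformly random perfect matching on the same $n$ vertices (i.e. of the complete graph $K_n$). Then with high probability $\alpha n$ cops do not suffice to catch the robber on $G$; that is, $\Pr[\mathrm{ent}(G)>\alpha n]\to1$ as $n\to\infty$ through even integers.
   Context: Entanglement game on a finite undirected graph $G$ with $k$ cops: First the robber chooses a starting vertex, and all $k$ cops are outside the graph. In every turn, the cops either all stay where they are, or exactly one of them flies (from wherever it is, on or off the graph) to the current position of the robber. Regardless of which of these happened, the robber then has to move to a neighbor of his current position that is not occupied by a cop. If there is no such neighbor, the cops win. The robber wins if he can run away indefinitely. Both sides have full information. The entanglement number $\mathrm{ent}(G)$ is the minimal integer $k$ such that $k$ cops have a strategy to catch the robber on $G$. "$\alpha n$ cops do not suffice" means that no integer number $k\le\alpha n$ of cops can catch the robber, i.e. $\mathrm{ent}(G)>\alpha n$. $H\cup M$ is the graph on the $n$ vertices whose edge set is the union of the edge sets of $H$ and $M$. The cycle $H$ is fixed (by symmetry it does not matter which one). "With high probability" means with probability tending to $1$ as $n\to\infty$. *)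

theory Defs
  imports "HOL-Probability.Probability"
begin

text \<open>A graph is given by a vertex set and a set of edges, each edge being a two-element
  set of vertices.\<close>

definition complete_edges :: "'a set \<Rightarrow> 'a set set" where
  "complete_edges V = {e. e \<subseteq> V \<and> card e = 2}"

definition hamiltonian_cycle :: "'a set \<Rightarrow> 'a set set \<Rightarrow> bool" where
  "hamiltonian_cycle V H \<longleftrightarrow> finite V \<and> card V \<ge> 3 \<and>
     (\<exists>f. bij_betw f {..<card V} V \<and> H = {{f i, f (Suc i mod card V)} | i. i < card V})"

definition perfect_matchings :: "'a set \<Rightarrow> 'a set set set" where
  "perfect_matchings V = {M. M \<subseteq> complete_edges V \<and> (\<forall>v\<in>V. \<exists>!e. e \<in> M \<and> v \<in> e)}"

text \<open>A strategy for the cops maps the list of all robber positions so far (the last entry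
  is the current one) to their move: \<open>None\<close> if all cops stay, \<open>Some i\<close> if cop \<open>i\<close> flies to the
  current position of the robber. Earlier cop moves need not be an argument, as they are
  determined by the strategy and the earlier robber positions.\<close>

type_synonym 'a cop_strategy = "'a list \<Rightarrow> nat option"

text \<open>\<open>cops_after \<sigma> r t i\<close> is the position of cop \<open>i\<close> after the first \<open>t\<close> moves of the cops,
  where \<open>r 0\<close> is the start vertex of the robber and \<open>r s\<close> his position after his \<open>s\<close>-th move;
  the value \<open>None\<close> means that the cop is outside the graph.\<close>

fun cops_after :: "'a cop_strategy \<Rightarrow> (nat \<Rightarrow> 'a) \<Rightarrow> nat \<Rightarrow> nat \<Rightarrow> 'a option" where
  "cops_after \<sigma> r 0 = (\<lambda>i. None)"
| "cops_after \<sigma> r (Suc t) =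
     (case \<sigma> (map r [0..<Suc t]) of
        None \<Rightarrow> cops_after \<sigma> r t
      | Some i \<Rightarrow> (cops_after \<sigma> r t)(i := Some (r t)))"

definition evades :: "'a set \<Rightarrow> 'a set set \<Rightarrow> 'a cop_strategy \<Rightarrow> (nat \<Rightarrow> 'a) \<Rightarrow> bool" where
  "evades V E \<sigma> r \<longleftrightarrow> r 0 \<in> V \<and>
     (\<forall>t. {r t, r (Suc t)} \<in> E \<and> (\<forall>i. cops_after \<sigma> r (Suc t) i \<noteq> Some (r (Suc t))))"

definition cops_suffice :: "'a set \<Rightarrow> 'a set set \<Rightarrow> nat \<Rightarrow> bool" where
  "cops_suffice V E k \<longleftrightarrow>
     (\<exists>\<sigma>. (\<forall>h i. \<sigma> h = Some i \<longrightarrow> i < k) \<and> (\<forall>r. \<not> evades V E \<sigma> r))"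

definition ent :: "'a set \<Rightarrow> 'a set set \<Rightarrow> nat" where
  "ent V E = (LEAST k. cops_suffice V E k)"

text \<open>The minimum is taken over a nonempty set of numbers.\<close>

lemma cops_suffice_card:
  assumes "finite V" "E \<subseteq> complete_edges V"
  shows "cops_suffice V E (card V)"
proof -
  define \<sigma> :: "'a cop_strategy" where
    "\<sigma> h = (if 0 < length h \<and> length h \<le> card V then Some (length h - 1) else None)" for h
  have False if ev: "evades V E \<sigma> r" for r
  proof -
    have pos: "cops_after \<sigma> r t i = Some (r i)" if "i < t" "t \<le> card V" for t i
      using that
    proof (induction t)
      case (Suc t)
      have "\<sigma> (map r [0..<Suc t]) = Some t"
        using Suc.prems by (simp add: \<sigma>_def)
      then have step: "cops_after \<sigma> r (Suc t) = (cops_after \<sigma> r t)(t := Some (r t))"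
        by simp
      show ?case
      proof (cases "i = t")
        case False
        with Suc.prems have "cops_after \<sigma> r t i = Some (r i)" by (intro Suc.IH) auto
        with False show ?thesis unfolding step by simp
      qed (simp add: step del: cops_after.simps)
    qed simp
    have edge: "{r t, r (Suc t)} \<in> E" for t
      using ev by (auto simp: evades_def)
    have inV: "r t \<in> V" for t
      using edge[of t] assms(2) by (auto simp: complete_edges_def)
    have neq: "r i \<noteq> r j" if ij: "i < j" "j \<le> card V" for i j
    proof -
      obtain t where t: "j = Suc t" using ij(1) by (cases j) auto
      have "cops_after \<sigma> r (Suc t) i \<noteq> Some (r (Suc t))"
        using ev unfolding evades_def by blast
      then show ?thesis using pos[OF ij] unfolding t by metis
    qed
    have "inj_on r {..card V}"
      unfolding inj_on_def by (metis neq atMost_iff linorder_neqE_nat)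
    then have "card {..card V} \<le> card V"
      using inV assms(1) by (intro card_inj_on_le[of r]) auto
    then show False by simp
  qed
  moreover have "\<forall>h i. \<sigma> h = Some i \<longrightarrow> i < card V"
    by (auto simp: \<sigma>_def neq_Nil_conv split: if_splits)
  ultimately show ?thesis
    unfolding cops_suffice_def by (intro exI[of _ \<sigma>]) blast
qed

end

(* Deterministic part: if removing any k + 1 vertices leaves a connected set with more than half
   of the vertices, the robber escapes k cops by always stepping into such a set.
   Random part: cut the Hamiltonian cycle into blocks of 100 consecutive vertices. There are only
   about 2^(n/100) unions of blocks, and two fixed disjoint sets with at least n/5 vertices each
   are joined by no matching edge with probability at most about (4/5)^(n/10). As 4 * (4/5)^10 < 1,
   with high probability any two disjoint unions of blocks of this size are joined. Removing at
   most n/1000 vertices damages at most a tenth of the cycle, and the undamaged blocks then contain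
   a large connected set. *)
theory Submission
  imports Defs
begin

section \<open>Counting perfect matchings\<close>

lemma perfect_matchings_remove_edge:
  assumes "M \<in> perfect_matchings V" "{a, x} \<in> M"
  shows "M - {{a, x}} \<in> perfect_matchings (V - {a, x})"
proof -
  have sub: "M \<subseteq> complete_edges V" and uniq: "\<And>v. v \<in> V \<Longrightarrow> \<exists>!e. e \<in> M \<and> v \<in> e"
    using assms(1) by (auto simp: perfect_matchings_def)
  have axV: "{a, x} \<subseteq> V"
    using sub assms(2) by (auto simp: complete_edges_def)
  have avoid: "a \<notin> e" "x \<notin> e" if "e \<in> M" "e \<noteq> {a, x}" for e
    using that uniq[of a] uniq[of x] axV assms(2) by blast+
  have "M - {{a, x}} \<subseteq> complete_edges (V - {a, x})"
    using sub avoid by (auto simp: complete_edges_def)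
  moreover have "\<exists>!e. e \<in> M - {{a, x}} \<and> v \<in> e" if "v \<in> V - {a, x}" for v
    using uniq[of v] that by auto
  ultimately show ?thesis
    by (simp add: perfect_matchings_def)
qed

lemma perfect_matchings_insert_edge:
  assumes "N \<in> perfect_matchings (V - {a, x})" "a \<in> V" "x \<in> V" "a \<noteq> x"
  shows "insert {a, x} N \<in> perfect_matchings V" "{a, x} \<notin> N"
proof -
  have sub: "N \<subseteq> complete_edges (V - {a, x})"
    and uniq: "\<And>v. v \<in> V - {a, x} \<Longrightarrow> \<exists>!e. e \<in> N \<and> v \<in> e"
    using assms(1) by (auto simp: perfect_matchings_def)
  have avoid: "a \<notin> e" "x \<notin> e" if "e \<in> N" for e
    using that sub by (auto simp: complete_edges_def)
  show "{a, x} \<notin> N"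
    using avoid by blast
  have "insert {a, x} N \<subseteq> complete_edges V"
    using sub assms(2-4) by (auto simp: complete_edges_def)
  moreover have "\<exists>!e. e \<in> insert {a, x} N \<and> v \<in> e" if "v \<in> V" for v
  proof (cases "v \<in> {a, x}")
    case True
    then show ?thesis using avoid by auto
  next
    case False
    then show ?thesis using uniq[of v] that by auto
  qed
  ultimately show "insert {a, x} N \<in> perfect_matchings V"
    by (simp add: perfect_matchings_def)
qed

text \<open>Deleting the edge and inserting it again are mutually inverse; this makes revealing one
  partner a recursion on smaller vertex sets.\<close>

lemma card_perfect_matchings_edge:
  assumes "a \<in> V" "x \<in> V" "a \<noteq> x"
  shows "card {M \<in> perfect_matchings V. {a, x} \<in> M} = card (perfect_matchings (V - {a, x}))"
proof (rule bij_betw_same_card, rule bij_betwI)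
  show "(\<lambda>M. M - {{a, x}}) \<in> {M \<in> perfect_matchings V. {a, x} \<in> M} \<rightarrow> perfect_matchings (V - {a, x})"
    by (auto intro: perfect_matchings_remove_edge)
  show "insert {a, x} \<in> perfect_matchings (V - {a, x}) \<rightarrow> {M \<in> perfect_matchings V. {a, x} \<in> M}"
    using assms by (auto intro: perfect_matchings_insert_edge)
  show "insert {a, x} N - {{a, x}} = N" if "N \<in> perfect_matchings (V - {a, x})" for N
    using perfect_matchings_insert_edge(2)[OF that assms] by blast
qed auto

lemma finite_perfect_matchings:
  assumes "finite V"
  shows "finite (perfect_matchings V)"
proof (rule finite_subset)
  show "perfect_matchings V \<subseteq> Pow (Pow V)"
    by (auto simp: perfect_matchings_def complete_edges_def)
qed (use assms in simp)

lemma perfect_matchings_partner: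
  assumes "M \<in> perfect_matchings V" "a \<in> V"
  obtains x where "x \<in> V - {a}" "{a, x} \<in> M"
proof -
  obtain e where e: "e \<in> M" "a \<in> e"
    using assms by (auto simp: perfect_matchings_def)
  then have "e \<subseteq> V" "card e = 2"
    using assms(1) by (auto simp: perfect_matchings_def complete_edges_def)
  then obtain x where "e = {a, x}" "x \<noteq> a"
    using e(2) by (auto simp: card_2_iff)
  then show ?thesis
    using that e \<open>e \<subseteq> V\<close> by auto
qed

text \<open>For even \<open>n\<close> this is the double factorial (n-1)(n-3)...3*1; for odd
  \<open>n\<close> the recursion ends in \<open>matching_number 1 = 0\<close>.\<close>

fun matching_number :: "nat \<Rightarrow> nat" where
  "matching_number 0 = 1"
| "matching_number (Suc n) = n * matching_number (n - 1)"

lemma matching_number_pos: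
  assumes "even n"
  shows "matching_number n > 0"
  using assms by (induction n rule: matching_number.induct) (auto elim!: oddE)

text \<open>Fix a vertex \<open>a\<close> and classify the matchings by its partner: each of the
  \<open>card V - 1\<close> choices leaves an arbitrary perfect matching of the other
  \<open>card V - 2\<close> vertices. The classes are disjoint because \<open>a\<close> lies in only
  one edge.\<close>

lemma card_perfect_matchings:
  assumes "finite V"
  shows "card (perfect_matchings V) = matching_number (card V)"
  using assms
proof (induction "card V" arbitrary: V rule: less_induct)
  case less
  show ?case
  proof (cases "V = {}")
    case True
    have "perfect_matchings {} = {{} :: 'a set set}"
      by (auto simp: perfect_matchings_def complete_edges_def)
    with True show ?thesis by simp
  next
    case False
    then obtain a where a: "a \<in> V" by blast
    define F where "F x = {M \<in> perfect_matchings V. {a, x} \<in> M}" for x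
    have "perfect_matchings V = (\<Union>x\<in>V - {a}. F x)"
      using perfect_matchings_partner[OF _ a] unfolding F_def by blast
    moreover have "card (\<Union>x\<in>V - {a}. F x) = (\<Sum>x\<in>V - {a}. card (F x))"
    proof (rule card_UN_disjoint)
      show "\<forall>x\<in>V - {a}. finite (F x)"
        using finite_perfect_matchings[OF less.prems] by (auto simp: F_def)
      show "\<forall>x\<in>V - {a}. \<forall>y\<in>V - {a}. x \<noteq> y \<longrightarrow> F x \<inter> F y = {}"
      proof (intro ballI impI)
        fix x y assume "x \<in> V - {a}" "y \<in> V - {a}" "x \<noteq> y"
        then have "{a, x} \<noteq> {a, y}" by (auto simp: doubleton_eq_iff)
        moreover have "e = e'" if "M \<in> perfect_matchings V" "e \<in> M" "e' \<in> M" "a \<in> e" "a \<in> e'" for M e e'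
          using that a unfolding perfect_matchings_def by blast
        ultimately show "F x \<inter> F y = {}"
          unfolding F_def by blast
      qed
    qed (use less.prems in auto)
    moreover have "card (F x) = matching_number (card V - 2)" if "x \<in> V - {a}" for x
    proof -
      have c: "card (V - {a, x}) = card V - 2"
        using that a by (subst card_Diff_subset) auto
      have "card (V - {a, x}) < card V"
        using a less.prems by (intro psubset_card_mono) auto
      then show ?thesis
        unfolding F_def using that a less c
        by (subst card_perfect_matchings_edge) auto
    qed
    ultimately have "card (perfect_matchings V) = (card V - 1) * matching_number (card V - 2)"
      using a by simp
    also obtain m where "card V = Suc m"
      using False less.prems by (cases "card V") auto
    then have "(card V - 1) * matching_number (card V - 2) = matching_number (card V)"
      by simp
    finally show ?thesis .
  qed
qed

text \<open>Reveal the partners of the vertices of \<open>A\<close> one by one. Each partner avoids \<open>B\<close> with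
  conditional probability at most \<open>q\<close>, and each step uses up at most two vertices of \<open>A\<close>.\<close>

lemma card_matchings_avoiding:
  fixes q :: real
  assumes "finite V" "A \<subseteq> V" "B \<subseteq> V" "A \<inter> B = {}" "2 * m \<le> card A"
    and "0 \<le> q" "q \<le> 1" "(1 - q) * card V \<le> card B"
  shows "card {M \<in> perfect_matchings V. \<forall>x\<in>A. \<forall>y\<in>B. {x, y} \<notin> M} \<le> q ^ m * matching_number (card V)"
  using assms(1-5,8)
proof (induction m arbitrary: V A)
  case 0
  then show ?case
    by (auto simp: card_perfect_matchings[symmetric] intro!: card_mono finite_perfect_matchings)
next
  case (Suc m)
  define bad where "bad V A = {M \<in> perfect_matchings V. \<forall>x\<in>A. \<forall>y\<in>B. {x, y} \<notin> M}" for V A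
  have finbad: "finite (bad V A)" if "finite V" for V A
    using finite_perfect_matchings[OF that] by (auto simp: bad_def)
  obtain a where a: "a \<in> A"
    using Suc.prems(5) by fastforce
  let ?U = "V - insert a B"
  define F where "F x = {M \<in> bad V A. {a, x} \<in> M}" for x
  have aB: "a \<in> V" "a \<notin> B"
    using a Suc.prems by auto
  have finB: "finite B"
    using Suc.prems finite_subset by blast
  have cV: "card B + 1 \<le> card V"
    using card_mono[OF Suc.prems(1), of "insert a B"] aB Suc.prems finB by auto
  have "bad V A \<subseteq> (\<Union>x\<in>?U. F x)"
  proof
    fix M assume M: "M \<in> bad V A"
    then have "M \<in> perfect_matchings V"
      by (simp add: bad_def)
    then obtain x where "x \<in> V - {a}" "{a, x} \<in> M"
      using aB(1) by (rule perfect_matchings_partner)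
    then show "M \<in> (\<Union>x\<in>?U. F x)"
      using M a by (auto simp: F_def bad_def)
  qed
  then have "card (bad V A) \<le> card (\<Union>x\<in>?U. F x)"
    using finbad[OF Suc.prems(1)] Suc.prems(1) by (intro card_mono) (auto simp: F_def)
  also have "\<dots> \<le> (\<Sum>x\<in>?U. card (F x))"
    using Suc.prems(1) by (intro card_UN_le) auto
  finally have "real (card (bad V A)) \<le> (\<Sum>x\<in>?U. real (card (F x)))"
    by (metis of_nat_le_iff of_nat_sum)
  also have "\<dots> \<le> (\<Sum>x\<in>?U. q ^ m * matching_number (card V - 2))"
  proof (rule sum_mono)
    fix x assume x: "x \<in> ?U"
    have c: "card (V - {a, x}) = card V - 2"
      using x aB by (subst card_Diff_subset) auto
    have "card (F x) \<le> card (bad (V - {a, x}) (A - {a, x}))"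
    proof (rule card_inj_on_le)
      show "inj_on (\<lambda>M. M - {{a, x}}) (F x)"
        by (auto simp: inj_on_def F_def)
      show "(\<lambda>M. M - {{a, x}}) ` F x \<subseteq> bad (V - {a, x}) (A - {a, x})"
        using perfect_matchings_remove_edge by (fastforce simp: F_def bad_def)
    qed (use finbad Suc.prems(1) in auto)
    also have "real \<dots> \<le> q ^ m * matching_number (card (V - {a, x}))"
      unfolding bad_def
    proof (rule Suc.IH)
      have "card A - card {a, x} \<le> card (A - {a, x})"
        by (rule diff_card_le_card_Diff) auto
      moreover have "card {a, x} \<le> 2"
        by (simp add: card_insert_if)
      ultimately have "card A - 2 \<le> card (A - {a, x})"
        by linarith
      moreover have "2 * m \<le> card A - 2"
        using Suc.prems(5) by simp
      ultimately show "2 * m \<le> card (A - {a, x})"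
        by (rule order_trans[rotated])
      \<comment> \<open>\<open>B\<close> stays fixed throughout the induction and \<open>x\<close>
        lies outside it, so shrinking \<open>V\<close> can only raise the share of
        \<open>B\<close>.\<close>
      have "(1 - q) * card (V - {a, x}) \<le> (1 - q) * card V"
        using assms(7) Suc.prems(1) by (intro mult_left_mono) (auto intro!: card_mono)
      with Suc.prems(6) show "(1 - q) * card (V - {a, x}) \<le> card B"
        by linarith
    qed (use Suc.prems x aB in auto)
    finally show "real (card (F x)) \<le> q ^ m * matching_number (card V - 2)"
      using c by simp
  qed
  also have "\<dots> = card ?U * (q ^ m * matching_number (card V - 2))"
    by simp
  \<comment> \<open>From \<open>V\<close> drop out \<open>a\<close> and at least
    \<open>(1 - q) * card V\<close> vertices of \<open>B\<close>; \<open>q \<le> 1\<close> then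
    turns \<open>q * card V - 1\<close> into a bound by \<open>q * (card V - 1)\<close>. The factor
    \<open>card V - 1\<close> is the one that the recursion of \<open>matching_number\<close>
    absorbs.\<close>
  also have "\<dots> \<le> (q * (card V - 1)) * (q ^ m * matching_number (card V - 2))"
  proof (rule mult_right_mono)
    have "card ?U = card V - (card B + 1)"
      using finB aB Suc.prems by (subst card_Diff_subset) auto
    then have "real (card ?U) = real (card V) - card B - 1"
      using cV by simp
    also have "\<dots> \<le> q * card V - 1"
      using Suc.prems(6) by (simp add: algebra_simps)
    also have "\<dots> \<le> q * (card V - 1)"
      using assms(7) cV by (simp add: of_nat_diff algebra_simps)
    finally show "real (card ?U) \<le> q * (card V - 1)" .
  qed (use assms(6) in auto)
  also have "\<dots> = q ^ Suc m * matching_number (card V)"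
    using cV by (cases "card V") auto
  finally show ?case
    by (simp add: bad_def)
qed

section \<open>Connected sets and havens\<close>

text \<open>Connectedness of the subgraph induced on \<open>D\<close>, stated by cuts instead of
  paths: the arguments below only ever need an edge that leaves a proper part.\<close>

definition connected_in :: "'a set set \<Rightarrow> 'a set \<Rightarrow> bool" where
  "connected_in E D \<longleftrightarrow> (\<forall>X. X \<subseteq> D \<and> X \<noteq> {} \<and> X \<noteq> D \<longrightarrow> (\<exists>x\<in>X. \<exists>y\<in>D - X. {x, y} \<in> E))"

lemma connected_inD:
  assumes "connected_in E D" "X \<subseteq> D" "X \<noteq> {}" "X \<noteq> D"
  obtains x y where "x \<in> X" "y \<in> D - X" "{x, y} \<in> E"
  using assms unfolding connected_in_def by blast

text \<open>A proper nonempty part of the union must split \<open>D\<close> or \<open>D'\<close>: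
  otherwise it contains or misses each of them entirely, and a common vertex forces the same
  alternative for both.\<close>

lemma connected_in_Un:
  assumes "connected_in E D" "connected_in E D'" "D \<inter> D' \<noteq> {}"
  shows "connected_in E (D \<union> D')"
  unfolding connected_in_def
proof (intro allI impI, elim conjE)
  fix X assume X: "X \<subseteq> D \<union> D'" "X \<noteq> {}" "X \<noteq> D \<union> D'"
  then consider "X \<inter> D \<noteq> {}" "X \<inter> D \<noteq> D" | "X \<inter> D' \<noteq> {}" "X \<inter> D' \<noteq> D'"
    using assms(3) by blast
  then show "\<exists>x\<in>X. \<exists>y\<in>D \<union> D' - X. {x, y} \<in> E"
  proof cases
    case 1
    then obtain x y where "x \<in> X \<inter> D" "y \<in> D - X \<inter> D" "{x, y} \<in> E"
      using connected_inD[OF assms(1) Int_lower2] by metis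
    then show ?thesis by blast
  next
    case 2
    then obtain x y where "x \<in> X \<inter> D'" "y \<in> D' - X \<inter> D'" "{x, y} \<in> E"
      using connected_inD[OF assms(2) Int_lower2] by metis
    then show ?thesis by blast
  qed
qed

lemma connected_in_insert:
  assumes "connected_in E D" "x \<in> D" "{x, y} \<in> E"
  shows "connected_in E (insert y D)"
proof -
  have "connected_in E {x, y}"
    unfolding connected_in_def
  proof (intro allI impI, elim conjE)
    fix X assume "X \<subseteq> {x, y}" "X \<noteq> {}" "X \<noteq> {x, y}"
    then have "X = {x} \<or> X = {y}" "x \<noteq> y" by blast+
    then show "\<exists>u\<in>X. \<exists>v\<in>{x, y} - X. {u, v} \<in> E"
      using assms(3) by (auto simp: insert_commute)
  qed
  then have "connected_in E ({x, y} \<union> D)"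
    using assms by (intro connected_in_Un) auto
  then show ?thesis
    using assms(2) by (simp add: insert_absorb)
qed

text \<open>Any two sets with more than half of the vertices meet. Hence the sets \<open>D\<close>
  for different \<open>C\<close> cohere as the values of a haven do, without one being selected for
  each \<open>C\<close>.\<close>

definition has_haven :: "'a set \<Rightarrow> 'a set set \<Rightarrow> nat \<Rightarrow> bool" where
  "has_haven V E k \<longleftrightarrow>
     (\<forall>C. C \<subseteq> V \<and> card C \<le> k \<longrightarrow> (\<exists>D. D \<subseteq> V - C \<and> connected_in E D \<and> card V < 2 * card D))"

text \<open>Take \<open>D'\<close> largest among the connected majority sets avoiding
  \<open>v\<close> and \<open>C\<close>. It meets \<open>D\<close>, so an edge leads from
  \<open>D'\<close> to some \<open>y\<close> in \<open>D - D'\<close>. As \<open>y\<close> is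
  outside \<open>C\<close>, it could be added to \<open>D'\<close> unless \<open>y = v\<close>; so
  maximality makes \<open>v\<close> a neighbour of \<open>D'\<close>.\<close>

lemma has_haven_step:
  assumes "finite V" "has_haven V E k" "C \<subseteq> V" "card (insert v C) \<le> k"
    and D: "D \<subseteq> V - C" "connected_in E D" "card V < 2 * card D" "v \<in> D"
  obtains x D' where "{v, x} \<in> E" "x \<in> D'" "D' \<subseteq> V - insert v C" "connected_in E D'" "card V < 2 * card D'"
proof -
  let ?P = "\<lambda>D'. D' \<subseteq> V - insert v C \<and> connected_in E D' \<and> card V < 2 * card D'"
  have vV: "v \<in> V" using D by blast
  then have "insert v C \<subseteq> V" using assms(3) by blast
  then obtain D0 where "?P D0"
    using assms(2,4) unfolding has_haven_def by blast
  moreover have "card D' < Suc (card V)" if "?P D'" for D'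
    using that assms(1) by (metis Diff_subset card_mono le_imp_less_Suc subset_trans)
  ultimately obtain D' where D': "?P D'" and max: "\<And>D''. ?P D'' \<Longrightarrow> card D'' \<le> card D'"
    using ex_has_greatest_nat[of ?P D0 card "Suc (card V)"] by metis
  have fin: "finite D" "finite D'"
    using D(1) D' assms(1) by (meson Diff_subset finite_subset)+
  have "D \<inter> D' \<noteq> {}"
  proof
    assume "D \<inter> D' = {}"
    then have "card (D \<union> D') = card D + card D'"
      using fin by (simp add: card_Un_disjoint)
    moreover have "card (D \<union> D') \<le> card V"
      using D(1) D' assms(1) by (intro card_mono) auto
    ultimately show False
      using D(3) D' by linarith
  qed
  then have "connected_in E (D \<union> D')"
    using D D' by (intro connected_in_Un) auto
  moreover have "D' \<noteq> {}" "D' \<noteq> D \<union> D'"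
    using D' D(4) by auto
  ultimately obtain x y where xy: "x \<in> D'" "y \<in> D \<union> D' - D'" "{x, y} \<in> E"
    using connected_inD[OF _ Un_upper2] by metis
  have "y = v"
  proof (rule ccontr)
    assume "y \<noteq> v"
    have c: "card (insert y D') = Suc (card D')"
      using xy fin by auto
    have "?P (insert y D')"
      using xy D D' \<open>y \<noteq> v\<close> c connected_in_insert[of E D' x y] by auto
    then show False using max[of "insert y D'"] c by simp
  qed
  then show ?thesis
    using that[of x D'] xy D' by (auto simp: insert_commute)
qed

section \<open>Escape strategy of the robber from a haven\<close>

text \<open>The first \<open>t\<close> cop moves see only the positions \<open>r 0\<close> to
  \<open>r (t - 1)\<close>. Thus a finite history can stand in for an infinite run.\<close>

lemma cops_after_cong:
  assumes "\<And>s. s < t \<Longrightarrow> r s = r' s"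
  shows "cops_after \<sigma> r t = cops_after \<sigma> r' t"
  using assms
proof (induction t)
  case (Suc t)
  have "map r [0..<Suc t] = map r' [0..<Suc t]"
    using Suc.prems by (intro map_cong) auto
  moreover have "cops_after \<sigma> r t = cops_after \<sigma> r' t" "r t = r' t"
    using Suc by auto
  ultimately show ?case
    by (simp only: cops_after.simps)
qed simp

definition cop_set :: "'a cop_strategy \<Rightarrow> (nat \<Rightarrow> 'a) \<Rightarrow> nat \<Rightarrow> 'a set" where
  "cop_set \<sigma> r t = {c. \<exists>i. cops_after \<sigma> r t i = Some c}"

text \<open>Only an inclusion, since the flying cop may vacate its old vertex.\<close>

lemma cop_set_Suc: "cop_set \<sigma> r (Suc t) \<subseteq> insert (r t) (cop_set \<sigma> r t)"
  by (auto simp: cop_set_def split: option.splits if_splits)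

text \<open>Cops with index at least \<open>k\<close> never enter the graph, so the occupied
  vertices are an image of a subset of \<open>{..<k}\<close>.\<close>

lemma card_cop_set:
  assumes "\<forall>h i. \<sigma> h = Some i \<longrightarrow> i < k"
  shows "finite (cop_set \<sigma> r t)" "card (cop_set \<sigma> r t) \<le> k"
proof -
  have none: "cops_after \<sigma> r t i = None" if "i \<ge> k" for i t
    using that
  proof (induction t)
    case (Suc t)
    moreover have "\<sigma> h \<noteq> Some i" for h
      using assms Suc.prems by (metis leD)
    ultimately show ?case
      by (auto split: option.splits simp del: upt_Suc)
  qed simp
  have sub: "cop_set \<sigma> r t \<subseteq> (\<lambda>i. the (cops_after \<sigma> r t i)) ` {..<k}"
  proof -
    have "c \<in> (\<lambda>i. the (cops_after \<sigma> r t i)) ` {..<k}" if "cops_after \<sigma> r t i = Some c" for c i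
      using that none[of i t] by (intro image_eqI[of _ _ i]) (auto simp: not_le[symmetric])
    then show ?thesis
      by (auto simp: cop_set_def)
  qed
  then show "finite (cop_set \<sigma> r t)"
    by (rule finite_subset) auto
  show "card (cop_set \<sigma> r t) \<le> k"
    using card_mono[OF _ sub] card_image_le[of "{..<k}" "\<lambda>i. the (cops_after \<sigma> r t i)"] by simp
qed

text \<open>The robber stays in a connected set containing more than half of the vertices and no cop.
  Whether or not a cop lands on him at \<open>v\<close>, a largest connected set avoiding \<open>v\<close> and the old cops still
  overlaps the set he was in, and by maximality \<open>v\<close> itself has a neighbour in it.\<close>

lemma has_haven_not_cops_suffice:
  assumes fin: "finite V" and haven: "has_haven V E (Suc k)"
  shows "\<not> cops_suffice V E k"
proof
  assume "cops_suffice V E k"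
  then obtain \<sigma> where \<sigma>: "\<forall>h i. \<sigma> h = Some i \<longrightarrow> i < k" and win: "\<And>r. \<not> evades V E \<sigma> r"
    unfolding cops_suffice_def by blast
  define safe where "safe C v \<longleftrightarrow>
    C \<subseteq> V \<and> (\<exists>D. D \<subseteq> V - C \<and> connected_in E D \<and> card V < 2 * card D \<and> v \<in> D)" for C v
  \<comment> \<open>The cops have not yet answered the last entry of \<open>h\<close>, hence
    \<open>length h - 1\<close> moves. What \<open>(!) h\<close> returns beyond the end of
    \<open>h\<close> has no influence on them.\<close>
  define cops where "cops h = cop_set \<sigma> ((!) h) (length h - 1)" for h
  \<comment> \<open>Dependent choice runs over whole histories, because the cops' next move depends
    on all earlier positions.\<close>
  have "\<exists>hs. \<forall>t. (length (hs t) = Suc t \<and> safe (cops (hs t)) (last (hs t))) \<and>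
          (\<exists>x. hs (Suc t) = hs t @ [x] \<and> {last (hs t), x} \<in> E)"
  proof (rule dependent_nat_choice, goal_cases)
    case 1
    obtain D where D: "D \<subseteq> V" "connected_in E D" "card V < 2 * card D"
      using haven unfolding has_haven_def by (elim allE[of _ "{}"]) auto
    then obtain v where "v \<in> D" by fastforce
    then have "safe (cops [v]) v"
      using D unfolding safe_def cops_def by (auto simp: cop_set_def)
    then show ?case
      by (intro exI[of _ "[v]"]) auto
  next
    case (2 h t)
    define v where "v = last h"
    have len: "length h = Suc t" and "safe (cops h) v"
      using 2 by (auto simp: v_def)
    then obtain D where D: "cops h \<subseteq> V" "D \<subseteq> V - cops h" "connected_in E D" "card V < 2 * card D" "v \<in> D"
      unfolding safe_def by blast
    have ht: "h ! t = v"
      using len by (cases h rule: rev_cases) (auto simp: v_def)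
    have cops_h: "cops h = cop_set \<sigma> ((!) h) t"
      using len by (simp add: cops_def)
    have cops_Suc: "cops (h @ [x]) = cop_set \<sigma> ((!) h) (Suc t)" for x
      unfolding cops_def cop_set_def using len
      by (subst cops_after_cong[of _ "(!) (h @ [x])" "(!) h"]) (auto simp: nth_append)
    obtain x where x: "{v, x} \<in> E" "safe (cop_set \<sigma> ((!) h) (Suc t)) x"
    proof -
      have sub: "cop_set \<sigma> ((!) h) (Suc t) \<subseteq> insert v (cops h)"
        using cop_set_Suc[of \<sigma> "(!) h" t] ht cops_h by metis
      \<comment> \<open>The extra 1 arises because all old cop positions are avoided together with
        \<open>v\<close>, whichever cop flies.\<close>
      have "card (insert v (cops h)) \<le> Suc k"
        using card_cop_set[OF \<sigma>, of "(!) h" t] cops_h by (simp add: card_insert_if)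
      then obtain x D' where "{v, x} \<in> E" "x \<in> D'" "D' \<subseteq> V - insert v (cops h)"
        "connected_in E D'" "card V < 2 * card D'"
        using has_haven_step[OF fin haven D(1) _ D(2-5)] by blast
      moreover have "cop_set \<sigma> ((!) h) (Suc t) \<subseteq> V"
        using sub D by blast
      ultimately show ?thesis
        using that[of x] sub unfolding safe_def by blast
    qed
    then show ?case
      using len cops_Suc by (intro exI[of _ "h @ [x]"]) (auto simp: v_def)
  qed
  then obtain hs where len: "\<And>t. length (hs t) = Suc t"
    and safe: "\<And>t. safe (cops (hs t)) (last (hs t))"
    and step: "\<And>t. \<exists>x. hs (Suc t) = hs t @ [x] \<and> {last (hs t), x} \<in> E"
    by blast
  define r where "r t = last (hs t)" for t
  have hs_nth: "hs t ! s = r s" if "s \<le> t" for s t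
    using that
  proof (induction t)
    case 0
    then show ?case using len[of 0] by (cases "hs 0" rule: rev_cases) (auto simp: r_def)
  next
    case (Suc t)
    obtain x where x: "hs (Suc t) = hs t @ [x]" using step by blast
    then show ?case
      using Suc len[of t] by (cases "s \<le> t") (auto simp: nth_append r_def le_Suc_eq)
  qed
  have cops: "cops (hs t) = cop_set \<sigma> r t" for t
    unfolding cops_def cop_set_def using len[of t] hs_nth
    by (subst cops_after_cong[of _ "(!) (hs t)" r]) auto
  have safe_r: "safe (cop_set \<sigma> r t) (r t)" for t
    using safe[of t] cops by (simp add: r_def)
  have "evades V E \<sigma> r"
    unfolding evades_def
  proof (intro conjI allI)
    show "r 0 \<in> V"
      using safe_r[of 0] by (auto simp: safe_def)
    show "{r t, r (Suc t)} \<in> E" for t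
      using step[of t] by (auto simp: r_def)
    show "cops_after \<sigma> r (Suc t) i \<noteq> Some (r (Suc t))" for t i
      using safe_r[of "Suc t"] unfolding safe_def cop_set_def by blast
  qed
  then show False using win by blast
qed

section \<open>Blocks of the Hamiltonian cycle\<close>

text \<open>Block \<open>s\<close> consists of the positions from \<open>s * L\<close> to
  \<open>s * L + L - 1\<close>, cut off at \<open>n\<close>; the last block may be shorter.\<close>

definition block_union :: "(nat \<Rightarrow> 'a) \<Rightarrow> nat \<Rightarrow> nat \<Rightarrow> nat set \<Rightarrow> 'a set" where
  "block_union f n L P = f ` {i. i < n \<and> i div L \<in> P}"

text \<open>Consecutive vertices of a block are adjacent, so a set without edges to the rest of the
  chosen blocks contains each block entirely or misses it. This leaves few enough candidates for a
  union bound.\<close>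

lemma edge_closed_eq_block_union:
  assumes edges: "\<And>i. Suc i < n \<Longrightarrow> {f i, f (Suc i)} \<in> E"
    and inj: "inj_on f {..<n}" and "L > 0"
    and X: "X \<subseteq> block_union f n L I"
    and closed: "\<And>x y. x \<in> X \<Longrightarrow> y \<in> block_union f n L I - X \<Longrightarrow> {x, y} \<notin> E"
  shows "X \<in> block_union f n L ` Pow {s. s * L < n}"
proof -
  \<comment> \<open>Walk along the block from its first vertex: if membership in \<open>X\<close>
    changed at some step, that edge would join \<open>X\<close> to the rest, in one orientation or
    the other.\<close>
  have const: "f (s * L + d) \<in> X \<longleftrightarrow> f (s * L) \<in> X" if "s \<in> I" "s * L + d < n" "d < L" for s d
    using that
  proof (induction d)
    case (Suc d)
    have div: "(s * L + e) div L = s" if "e < L" for e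
      using that by (simp add: div_mult_self3)
    have "f (s * L + d) \<in> block_union f n L I" "f (s * L + Suc d) \<in> block_union f n L I"
      unfolding block_union_def using Suc.prems div[of d] div[of "Suc d"] by auto
    moreover have "{f (s * L + d), f (s * L + Suc d)} \<in> E" "{f (s * L + Suc d), f (s * L + d)} \<in> E"
      using edges[of "s * L + d"] Suc.prems by (auto simp: insert_commute)
    ultimately have "f (s * L + d) \<in> X \<longleftrightarrow> f (s * L + Suc d) \<in> X"
      using closed by blast
    then show ?case using Suc by simp
  qed simp
  have dm: "i div L * L + i mod L = i" "i mod L < L" "i div L * L \<le> i" for i
    using \<open>L > 0\<close> by (auto simp: div_mult_mod_eq)
  have mem: "f i \<in> X \<longleftrightarrow> f (i div L * L) \<in> X" if "i div L \<in> I" "i < n" for i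
    using const[of "i div L" "i mod L"] dm[of i] that by simp
  have inI: "i div L \<in> I" if i: "f i \<in> X" "i < n" for i
  proof -
    obtain j where "j < n" "j div L \<in> I" "f i = f j"
      using subsetD[OF X i(1)] by (auto simp: block_union_def)
    then show ?thesis
      using inj i(2) by (metis inj_onD lessThan_iff)
  qed
  \<comment> \<open>The first vertex of a block decides whether the block belongs to
    \<open>X\<close>.\<close>
  have "X = block_union f n L {s. s * L < n \<and> f (s * L) \<in> X}"
  proof (intro equalityI subsetI)
    fix x assume "x \<in> X"
    then obtain i where i: "i < n" "i div L \<in> I" "x = f i"
      using X by (auto simp: block_union_def)
    then show "x \<in> block_union f n L {s. s * L < n \<and> f (s * L) \<in> X}"
      unfolding block_union_def using mem[of i] \<open>x \<in> X\<close> le_less_trans[OF dm(3) i(1)]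
      by (intro image_eqI[of _ _ i]) auto
  next
    fix x assume "x \<in> block_union f n L {s. s * L < n \<and> f (s * L) \<in> X}"
    then obtain i where i: "i < n" "x = f i" "i div L * L < n" "f (i div L * L) \<in> X"
      by (auto simp: block_union_def)
    then have "i div L \<in> I"
      using inI[of "i div L * L"] \<open>L > 0\<close> by simp
    then show "x \<in> X"
      using mem[of i] i by simp
  qed
  then show ?thesis
    by (rule image_eqI) auto
qed

text \<open>The cops touch few blocks. Among the edge-closed subsets of the untouched part \<open>W\<close> with at
  least a fifth of all vertices take a smallest one, \<open>X\<close>. Then \<open>X\<close> and \<open>W - X\<close> are unions of blocks,
  so \<open>W - X\<close> is small, whereas a splitting of \<open>X\<close> would have two small parts by minimality.\<close>

lemma has_haven_if_blocks_joined:
  assumes bij: "bij_betw f {..<n} V"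
    and edges: "\<And>i. Suc i < n \<Longrightarrow> {f i, f (Suc i)} \<in> E"
    and joined: "\<And>A B. A \<in> block_union f n L ` Pow {s. s * L < n} \<Longrightarrow>
      B \<in> block_union f n L ` Pow {s. s * L < n} \<Longrightarrow> A \<inter> B = {} \<Longrightarrow> n \<le> 5 * card A \<Longrightarrow>
      n \<le> 5 * card B \<Longrightarrow> \<exists>x\<in>A. \<exists>y\<in>B. {x, y} \<in> E"
    and "L > 0" "n > 0" "10 * L * k \<le> n"
  shows "has_haven V E k"
  unfolding has_haven_def
proof (intro allI impI, elim conjE)
  fix C assume C: "C \<subseteq> V" "card C \<le> k"
  have inj: "inj_on f {..<n}" and V: "V = f ` {..<n}"
    using bij by (auto simp: bij_betw_def)
  have finV: "finite V" and cardV: "card V = n"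
    using V card_image[OF inj] by auto
  define I where "I = {s. block_union f n L {s} \<inter> C = {}}"
  define W where "W = block_union f n L I"
  have WV: "W \<subseteq> V"
    unfolding W_def V block_union_def by auto
  have WC: "W \<inter> C = {}"
    unfolding W_def I_def by (auto simp: block_union_def)
  have finW: "finite W"
    using WV finV by (rule finite_subset)
  define g where "g = inv_into {..<n} f"
  \<comment> \<open>A lost vertex shares its block with some \<open>c\<close> in \<open>C\<close>,
    whose position is \<open>g c\<close>. So at most \<open>k\<close> blocks of at most
    \<open>L\<close> vertices are lost, in total at most a tenth of \<open>n\<close>.\<close>
  have "V - W \<subseteq> (\<Union>c\<in>C. block_union f n L {g c div L})"
  proof
    fix v assume "v \<in> V - W"
    then obtain i where i: "i < n" "v = f i" "i div L \<notin> I"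
      unfolding V W_def block_union_def by auto
    then obtain c where c: "c \<in> block_union f n L {i div L}" "c \<in> C"
      unfolding I_def by blast
    then obtain j where j: "j < n" "c = f j" "j div L = i div L"
      by (auto simp: block_union_def)
    then have "g c = j"
      unfolding g_def using inj by (simp add: inv_into_f_f)
    then show "v \<in> (\<Union>c\<in>C. block_union f n L {g c div L})"
      using c(2) i j by (auto simp: block_union_def intro!: bexI[of _ c])
  qed
  moreover have card_block: "card (block_union f n L {s}) \<le> L" "finite (block_union f n L {s})" for s
  proof -
    have "i \<in> {s * L..<s * L + L}" if "i div L = s" for i
      using that div_mult_mod_eq[of i L] mod_less_divisor[OF \<open>L > 0\<close>, of i] by auto
    then have sub: "block_union f n L {s} \<subseteq> f ` {s * L..<s * L + L}"
      unfolding block_union_def by blast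
    then show "finite (block_union f n L {s})"
      by (rule finite_subset) auto
    show "card (block_union f n L {s}) \<le> L"
      using card_mono[OF _ sub] card_image_le[of "{s * L..<s * L + L}" f] by simp
  qed
  moreover have finC: "finite C"
    using C(1) finV by (rule finite_subset)
  ultimately have "card (V - W) \<le> card (\<Union>c\<in>C. block_union f n L {g c div L})"
    by (intro card_mono) auto
  also have "\<dots> \<le> (\<Sum>c\<in>C. card (block_union f n L {g c div L}))"
    using finC by (rule card_UN_le)
  also have "\<dots> \<le> (\<Sum>c\<in>C. L)"
    using card_block(1) by (rule sum_mono)
  also have "\<dots> \<le> k * L"
    using C(2) by simp
  finally have "10 * card (V - W) \<le> n"
    using assms(6) by (simp add: mult_ac)
  moreover have "card V = card W + card (V - W)"
    using card_Un_disjoint[of W "V - W"] finW finV WV by (simp add: Un_absorb1)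
  ultimately have cW: "9 * n \<le> 10 * card W"
    using cardV by simp

  define closed where "closed X \<longleftrightarrow> X \<subseteq> W \<and> (\<forall>x\<in>X. \<forall>y\<in>W - X. {x, y} \<notin> E)" for X
  let ?P = "\<lambda>X. closed X \<and> n \<le> 5 * card X"
  have block: "X \<in> block_union f n L ` Pow {s. s * L < n}" if "closed X" for X
    using that by (intro edge_closed_eq_block_union[OF edges inj \<open>L > 0\<close>, where I = I])
      (auto simp: closed_def W_def)
  have "?P W"
    using cW by (auto simp: closed_def)
  then obtain X where X: "?P X" and min: "\<And>Y. ?P Y \<Longrightarrow> card X \<le> card Y"
    using ex_has_least_nat[of ?P W card] by metis
  have XW: "X \<subseteq> W" and finX: "finite X"
    using X finW by (auto simp: closed_def intro: finite_subset)
  have "closed (W - X)"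
    using X by (fastforce simp: closed_def insert_commute)
  have "5 * card (W - X) < n"
  proof (rule ccontr)
    assume "\<not> 5 * card (W - X) < n"
    then have "\<exists>x\<in>X. \<exists>y\<in>W - X. {x, y} \<in> E"
      using X block \<open>closed (W - X)\<close> by (intro joined) auto
    then show False
      using X by (auto simp: closed_def)
  qed
  moreover have "card W = card X + card (W - X)"
    using card_Un_disjoint[of X "W - X"] finW finX XW by (simp add: Un_absorb1)
  \<comment> \<open>9/10 - 1/5 = 7/10. This exceeds both the required half and the 2/5 that two
    small parts could cover.\<close>
  ultimately have cX: "7 * n < 10 * card X"
    using cW by linarith
  have "connected_in E X"
    unfolding connected_in_def
  proof (intro allI impI, elim conjE)
    fix Y assume Y: "Y \<subseteq> X" "Y \<noteq> {}" "Y \<noteq> X"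
    show "\<exists>x\<in>Y. \<exists>y\<in>X - Y. {x, y} \<in> E"
    proof (rule ccontr)
      assume no: "\<not> ?thesis"
      \<comment> \<open>Edges to \<open>W - X\<close> are excluded because \<open>X\<close> is
        closed, edges between the two parts by \<open>no\<close>.\<close>
      have "closed Y" "closed (X - Y)"
        using X no Y(1) unfolding closed_def by (metis Diff_iff insert_commute subset_iff)+
      moreover have "card Y < card X" "card (X - Y) < card X"
        using Y finX by (auto intro!: psubset_card_mono)
      ultimately have "5 * card Y < n" "5 * card (X - Y) < n"
        using min[of Y] min[of "X - Y"] by (meson leD not_le)+
      moreover have "card X = card Y + card (X - Y)"
        using card_Un_disjoint[of Y "X - Y"] finX Y by (simp add: Un_absorb1 finite_subset)
      ultimately show False
        using cX by linarith
    qed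
  qed
  then show "\<exists>D\<subseteq>V - C. connected_in E D \<and> card V < 2 * card D"
    using XW WV WC cX cardV by (intro exI[of _ X]) auto
qed

section \<open>Union bound over pairs of block unions\<close>

text \<open>With \<open>t = n div 100\<close> there are at most \<open>2 ^ (t + 1)\<close> block
  unions, hence at most \<open>4 ^ (t + 1)\<close> pairs, and each pair is unjoined in at most a
  \<open>(4 / 5) ^ (10 * t)\<close> fraction of the matchings.\<close>

lemma card_matchings_not_joining_blocks:
  fixes f :: "nat \<Rightarrow> 'a" and n :: nat
  assumes bij: "bij_betw f {..<n} V"
  defines "F \<equiv> block_union f n 100 ` Pow {s. s * 100 < n}"
  shows "card {M \<in> perfect_matchings V. \<exists>A\<in>F. \<exists>B\<in>F. A \<inter> B = {} \<and> n \<le> 5 * card A \<and> n \<le> 5 * card B \<and>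
           (\<forall>x\<in>A. \<forall>y\<in>B. {x, y} \<notin> M)}
         \<le> 4 * (4 * (4 / 5) ^ 10) ^ (n div 100) * real (card (perfect_matchings V))"
    (is "real (card ?Bad) \<le> _")
proof -
  have finV: "finite V" and cardV: "card V = n"
    using bij by (auto simp: bij_betw_def card_image)
  define t where "t = n div 100"
  define R where "R = {(A, B) \<in> F \<times> F. A \<inter> B = {} \<and> n \<le> 5 * card A \<and> n \<le> 5 * card B}"
  define bad where "bad p = {M \<in> perfect_matchings V. \<forall>x\<in>fst p. \<forall>y\<in>snd p. {x, y} \<notin> M}" for p
  let ?b = "(4 / 5) ^ (10 * t) * real (card (perfect_matchings V))"
  \<comment> \<open>An incomplete last block accounts for the index \<open>t\<close>, so up to
    \<open>t + 1\<close> blocks occur.\<close>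
  have sub: "{s. s * 100 < n} \<subseteq> {..t}"
    by (auto simp: t_def)
  then have fin: "finite {s. s * 100 < n}"
    by (rule finite_subset) auto
  have "card F \<le> card (Pow {s. s * 100 < n})"
    unfolding F_def using fin by (intro card_image_le) auto
  also have "\<dots> = 2 ^ card {s. s * 100 < n}"
    using fin by (rule card_Pow)
  also have "\<dots> \<le> 2 ^ Suc t"
    using card_mono[OF _ sub] by (intro power_increasing) auto
  finally have cF: "card F \<le> 2 ^ Suc t" .
  have finF: "finite F"
    unfolding F_def using fin by auto
  have FV: "A \<subseteq> V" if "A \<in> F" for A
    using that bij by (auto simp: F_def block_union_def bij_betw_def)
  have finR: "finite R"
    by (rule finite_subset[of _ "F \<times> F"]) (use finF in \<open>auto simp: R_def\<close>)
  have "card R \<le> card (F \<times> F)"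
    using finF unfolding R_def by (intro card_mono) auto
  also have "\<dots> \<le> 2 ^ Suc t * 2 ^ Suc t"
    unfolding card_cartesian_product using cF cF by (rule mult_mono) auto
  also have "\<dots> = (4::nat) ^ Suc t"
    by (simp add: power_mult_distrib[symmetric])
  finally have cR: "real (card R) \<le> 4 ^ Suc t"
    by (metis of_nat_le_iff of_nat_numeral of_nat_power)
  have "?Bad = (\<Union>p\<in>R. bad p)"
  proof (intro equalityI subsetI)
    fix M assume "M \<in> ?Bad"
    then obtain A B where "(A, B) \<in> R" "M \<in> bad (A, B)"
      unfolding R_def bad_def by auto
    then show "M \<in> (\<Union>p\<in>R. bad p)"
      by blast
  next
    fix M assume "M \<in> (\<Union>p\<in>R. bad p)"
    then obtain A B where "(A, B) \<in> R" "M \<in> bad (A, B)"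
      by auto
    then show "M \<in> ?Bad"
      unfolding R_def bad_def by simp blast
  qed
  then have "card ?Bad \<le> (\<Sum>p\<in>R. card (bad p))"
    using card_UN_le[OF finR, of bad] by simp
  then have "real (card ?Bad) \<le> (\<Sum>p\<in>R. real (card (bad p)))"
    by (simp only: of_nat_sum[symmetric] of_nat_le_iff)
  also have "\<dots> \<le> (\<Sum>p\<in>R. ?b)"
  proof (rule sum_mono)
    fix p assume "p \<in> R"
    then obtain A B where p: "p = (A, B)" "A \<in> F" "B \<in> F" "A \<inter> B = {}" "n \<le> 5 * card A" "n \<le> 5 * card B"
      unfolding R_def by auto
    \<comment> \<open>\<open>A\<close> has at least \<open>n / 5\<close>, so at least
      \<open>20 * t\<close>, vertices, which allows \<open>10 * t\<close> revealing steps;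
      \<open>B\<close> holds at least a fifth of all vertices, which gives
      \<open>q = 4 / 5\<close>.\<close>
    have "card (bad p) \<le> (4 / 5) ^ (10 * t) * matching_number (card V)"
      unfolding bad_def p(1) fst_conv snd_conv
    proof (rule card_matchings_avoiding)
      show "2 * (10 * t) \<le> card A"
        using p(5) unfolding t_def by linarith
      show "(1 - 4 / 5) * card V \<le> card B"
        using p(6) cardV by simp
    qed (use finV FV p in auto)
    then show "real (card (bad p)) \<le> ?b"
      using finV by (simp add: card_perfect_matchings)
  qed
  also have "\<dots> \<le> 4 ^ Suc t * ?b"
    using mult_right_mono[OF cR, of ?b] by simp
  also have "\<dots> = 4 * (4 * (4 / 5) ^ 10) ^ t * real (card (perfect_matchings V))"
    by (simp add: power_mult_distrib power_mult)
  finally show ?thesis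
    by (simp add: t_def)
qed

section \<open>Assembling the probability estimate\<close>

lemma hamiltonian_cycle_complete_edges:
  assumes "hamiltonian_cycle V H"
  shows "H \<subseteq> complete_edges V"
proof
  fix e assume "e \<in> H"
  then obtain f i where f: "bij_betw f {..<card V} V" and i: "i < card V" "e = {f i, f (Suc i mod card V)}"
    and "3 \<le> card V"
    using assms unfolding hamiltonian_cycle_def by auto
  have j: "Suc i mod card V < card V"
    using i by simp
  have "i \<noteq> Suc i mod card V"
    using i \<open>3 \<le> card V\<close> by (auto simp: mod_Suc)
  then have "f i \<noteq> f (Suc i mod card V)"
    using f i j by (metis bij_betw_def inj_onD lessThan_iff)
  then show "e \<in> complete_edges V"
    using f i j by (auto simp: complete_edges_def bij_betw_def)
qed

theorem corollary2:
  "\<exists>\<alpha>::real. \<alpha> > 0 \<and>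
     (\<forall>H :: nat \<Rightarrow> nat set set.
        (\<forall>n. even n \<and> n \<ge> 3 \<longrightarrow> hamiltonian_cycle {..<n} (H n)) \<longrightarrow>
        ((\<lambda>n. measure_pmf.prob (pmf_of_set (perfect_matchings {..<n}))
                {M. real (ent {..<n} (H n \<union> M)) > \<alpha> * real n}) \<longlongrightarrow> 1)
          (inf at_top (principal {n. even n})))"
proof (intro exI[of _ "1 / 2000"] conjI allI impI)
  fix H :: "nat \<Rightarrow> nat set set"
  assume H: "\<forall>n. even n \<and> n \<ge> 3 \<longrightarrow> hamiltonian_cycle {..<n} (H n)"
  let ?prob = "\<lambda>n. measure_pmf.prob (pmf_of_set (perfect_matchings {..<n}))
                {M. real (ent {..<n} (H n \<union> M)) > 1 / 2000 * real n}"
  let ?p = "\<lambda>n. 4 * (4 * (4 / 5) ^ 10) ^ (n div 100) :: real"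
  have lower: "1 - ?p n \<le> ?prob n" if n: "n \<ge> 2000" "even n" for n
  proof -
    define S where "S = perfect_matchings {..<n}"
    define T where "T = {M. real (ent {..<n} (H n \<union> M)) > 1 / 2000 * real n}"
    have ham: "hamiltonian_cycle {..<n} (H n)"
      using H n by auto
    then obtain f where f: "bij_betw f {..<n} {..<n}" and Hf: "H n = {{f i, f (Suc i mod n)} | i. i < n}"
      unfolding hamiltonian_cycle_def by auto
    define F where "F = block_union f n 100 ` Pow {s. s * 100 < n}"
    define Bad where "Bad = {M \<in> S. \<exists>A\<in>F. \<exists>B\<in>F. A \<inter> B = {} \<and> n \<le> 5 * card A \<and> n \<le> 5 * card B \<and>
           (\<forall>x\<in>A. \<forall>y\<in>B. {x, y} \<notin> M)}"
    \<comment> \<open>\<open>pmf_of_set\<close> is the uniform distribution only for a finite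
      nonempty set; a perfect matching exists because \<open>n\<close> is even.\<close>
    have finS: "finite S" and S0: "card S > 0"
      using matching_number_pos[OF n(2)]
      by (auto simp: S_def card_perfect_matchings finite_perfect_matchings)
    have "S - Bad \<subseteq> T"
    proof
      fix M assume M: "M \<in> S - Bad"
      let ?E = "H n \<union> M"
      define k where "k = ent {..<n} ?E"
      have "?E \<subseteq> complete_edges {..<n}"
        using hamiltonian_cycle_complete_edges[OF ham] M by (auto simp: S_def perfect_matchings_def)
      \<comment> \<open>\<open>LEAST\<close> attains its value because \<open>card V\<close> cops
        always suffice.\<close>
      then have suffice: "cops_suffice {..<n} ?E k"
        unfolding k_def ent_def by (intro LeastI[of "cops_suffice {..<n} ?E" "card {..<n}"] cops_suffice_card) auto
      have "real k > 1 / 2000 * real n"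
      proof (rule ccontr)
        assume "\<not> ?thesis"
        then have "real (2000 * k) \<le> real n"
          by simp
        then have "2000 * k \<le> n"
          by (rule of_nat_le_iff[THEN iffD1])
        \<comment> \<open>This is where 1/2000 comes from: avoiding \<open>Suc k\<close> vertices
          with blocks of length 100 requires \<open>1000 * Suc k \<le> n\<close>. One half of
          \<open>n\<close> covers \<open>1000 * k\<close>, and \<open>n \<ge> 2000\<close> lets the
          other half cover the remaining 1000.\<close>
        then have k: "1000 * k + 1000 \<le> n"
          using n by linarith
        have "has_haven {..<n} ?E (Suc k)"
        proof (rule has_haven_if_blocks_joined[OF f, where L = 100])
          show "{f i, f (Suc i)} \<in> ?E" if "Suc i < n" for i
            using that by (auto simp: Hf intro!: exI[of _ i])
          show "\<exists>x\<in>A. \<exists>y\<in>B. {x, y} \<in> ?E"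
            if "A \<in> block_union f n 100 ` Pow {s. s * 100 < n}" "B \<in> block_union f n 100 ` Pow {s. s * 100 < n}"
              "A \<inter> B = {}" "n \<le> 5 * card A" "n \<le> 5 * card B" for A B
            using M that unfolding Bad_def F_def[symmetric] by blast
        qed (use k n in auto)
        then have "\<not> cops_suffice {..<n} ?E k"
          by (intro has_haven_not_cops_suffice) auto
        then show False
          using suffice by blast
      qed
      then show "M \<in> T"
        by (simp add: T_def k_def)
    qed
    then have "card (S - Bad) \<le> card (S \<inter> T)"
      using finS by (intro card_mono) auto
    moreover have "card (S - Bad) = card S - card Bad" "card Bad \<le> card S"
      using finS by (auto simp: Bad_def card_Diff_subset intro!: card_mono)
    ultimately have "real (card S) - card Bad \<le> card (S \<inter> T)"
      by linarith
    moreover have "real (card Bad) \<le> ?p n * real (card S)"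
      using card_matchings_not_joining_blocks[OF f] by (simp add: Bad_def F_def S_def)
    ultimately have "(1 - ?p n) * card S \<le> card (S \<inter> T)"
      by (simp add: algebra_simps)
    then have "1 - ?p n \<le> card (S \<inter> T) / card S"
      using S0 by (simp add: pos_le_divide_eq)
    also have "\<dots> = measure_pmf.prob (pmf_of_set S) T"
      using finS S0 by (subst measure_pmf_of_set) auto
    finally show ?thesis
      by (simp add: S_def T_def)
  qed
  have "filterlim (\<lambda>n::nat. n div 100) at_top at_top"
    by (rule filterlim_at_top_div_const_nat) auto
  \<comment> \<open>The base is about 0.43; blocks of length 100 are long enough to push it below
    1.\<close>
  moreover have "(\<lambda>t. (4 * (4 / 5) ^ 10 :: real) ^ t) \<longlonglongrightarrow> 0"
    by (rule LIMSEQ_power_zero) (simp add: power_divide)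
  ultimately have "(\<lambda>n. (4 * (4 / 5) ^ 10 :: real) ^ (n div 100)) \<longlonglongrightarrow> 0"
    by (rule filterlim_compose[rotated])
  then have "(\<lambda>n. 1 - ?p n) \<longlonglongrightarrow> 1 - 4 * 0"
    by (intro tendsto_intros)
  then have "((\<lambda>n. 1 - ?p n) \<longlongrightarrow> 1) (inf at_top (principal {n. even n}))"
    using tendsto_mono[OF inf_le1] by fastforce
  \<comment> \<open>Sandwich between \<open>1 - ?p n\<close> and the constant 1, which bounds every
    probability.\<close>
  then show "(?prob \<longlongrightarrow> 1) (inf at_top (principal {n. even n}))"
  proof (rule tendsto_sandwich[rotated 2])
    show "\<forall>\<^sub>F n in inf at_top (principal {n. even n}). 1 - ?p n \<le> ?prob n"
      unfolding eventually_inf_principal using eventually_ge_at_top[of "2000::nat"]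
      by eventually_elim (use lower in blast)
  qed auto
qed simp

end
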